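(* Let $p = p(n) \in [0,1]$ be a sequence with $p = o(n^{-2/3})$ as $n\to\infty$. Then the random graph $G(n,p)$ is locally symmetric asymptotically almost surely, i.e. $\mathbb{P}[G(n,p)\text{ is locally symmetric}] \to 1$ as $n\to\infty$.
   Context: Graphs are finite, simple and undirected. $G(n,p)$ is the Erdős–Rényi random graph on $n$ labeled vertices in which each of the $\binom n2$ possible edges is present independently with probability $p$. For a vertex $v$ of a graph $G$, let $\mathcal{N}(v)$ be the set consisting of $v$ and all its neighbors, and let $\mathcal{N}[v] = G[\mathcal{N}(v)]$ be the subgraph of $G$ induced by this set. Two vertices $v_1,v_2$ of $G$ are locally symmetric (i.e. $1$-locally symmetric) if there is a graph isomorphism $f$ from $\mathcal{N}[v_1]$ to $\mathcal{N}[v_2]$ with $f(v_1)=v_2$. The graph $G$ is locally symmetric if it has two distinct vertices that are locally symmetric. *)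

theory Defs
  imports "HOL-Probability.Probability" "HOL-Library.Landau_Symbols"
begin

record 'a ugraph =
  verts :: "'a set"
  edges :: "'a set set"

definition vertex_pairs :: "'a set \<Rightarrow> 'a set set" where
  "vertex_pairs V = {e. e \<subseteq> V \<and> card e = 2}"

definition simple_graph :: "'a ugraph \<Rightarrow> bool" where
  "simple_graph G \<longleftrightarrow> finite (verts G) \<and> edges G \<subseteq> vertex_pairs (verts G)"

definition closed_nbhd :: "'a ugraph \<Rightarrow> 'a \<Rightarrow> 'a set" where
  "closed_nbhd G v = insert v {u \<in> verts G. {v, u} \<in> edges G}"

definition induced_subgraph :: "'a ugraph \<Rightarrow> 'a set \<Rightarrow> 'a ugraph" where
  "induced_subgraph G S = \<lparr>verts = S, edges = {e \<in> edges G. e \<subseteq> S}\<rparr>"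

definition nbhd_graph :: "'a ugraph \<Rightarrow> 'a \<Rightarrow> 'a ugraph" where
  "nbhd_graph G v = induced_subgraph G (closed_nbhd G v)"

definition graph_isomorphism :: "('a \<Rightarrow> 'b) \<Rightarrow> 'a ugraph \<Rightarrow> 'b ugraph \<Rightarrow> bool" where
  "graph_isomorphism f G H \<longleftrightarrow>
     bij_betw f (verts G) (verts H) \<and>
     (\<forall>u \<in> verts G. \<forall>w \<in> verts G. {u, w} \<in> edges G \<longleftrightarrow> {f u, f w} \<in> edges H)"

definition locally_symmetric_vertices :: "'a ugraph \<Rightarrow> 'a \<Rightarrow> 'a \<Rightarrow> bool" where
  "locally_symmetric_vertices G v1 v2 \<longleftrightarrow>
     (\<exists>f. graph_isomorphism f (nbhd_graph G v1) (nbhd_graph G v2) \<and> f v1 = v2)"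

definition locally_symmetric :: "'a ugraph \<Rightarrow> bool" where
  "locally_symmetric G \<longleftrightarrow>
     (\<exists>v1 \<in> verts G. \<exists>v2 \<in> verts G. v1 \<noteq> v2 \<and> locally_symmetric_vertices G v1 v2)"

text \<open>
  One independent Bernoulli variable per potential edge. The library truncates the
  parameter of \<^const>\<open>bernoulli_pmf\<close> to the unit interval, so the distribution is the
  intended one only for \<open>0 \<le> p \<le> 1\<close>.
\<close>

definition erdos_renyi :: "nat \<Rightarrow> real \<Rightarrow> nat ugraph pmf" where
  "erdos_renyi n p =
     map_pmf (\<lambda>X. \<lparr>verts = {1..n}, edges = {e \<in> vertex_pairs {1..n}. X e}\<rparr>)
       (Pi_pmf (vertex_pairs {1..n}) False (\<lambda>_. bernoulli_pmf p))"

lemma erdos_renyi_simple_graph: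
  assumes "G \<in> set_pmf (erdos_renyi n p)"
  shows "simple_graph G" and "verts G = {1..n}"
  using assms by (auto simp: erdos_renyi_def simple_graph_def)

end

theory Submission
  imports Defs
begin

text \<open>
  In a graph, the closed neighbourhood of a vertex that lies in no triangle induces a star centred
  at that vertex, and two such vertices are locally symmetric as soon as their degrees agree
  (\<open>locally_symmetric_if_triangle_free_same_degree\<close>). Only \<open>k\<close> degrees are smaller than \<open>k\<close>, so in
  a graph on \<open>n\<close> vertices that is not locally symmetric all but at most \<open>k\<close> vertices are
  exceptional: they lie in a triangle or have degree at least \<open>k\<close>
  (\<open>many_exceptional_if_not_locally_symmetric\<close>).

  In \<open>G(n,p)\<close> a fixed vertex lies in a triangle with probability at most \<open>n\<^sup>2 p\<^sup>3\<close>, and by Markov's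
  inequality it has degree at least \<open>k\<close> with probability at most \<open>n p / k\<close>. With \<open>k\<close> close to
  \<open>n / 2\<close>, both bounds tend to \<open>0\<close> when \<open>p = o(n\<^bsup>-2/3\<^esup>)\<close>; the exponent is the one at which
  \<open>n\<^sup>2 p\<^sup>3\<close> stops tending to \<open>0\<close>. The expected number of exceptional vertices is then \<open>o(n)\<close>, and a
  second use of Markov's inequality shows that it is unlikely that half of all vertices are
  exceptional.
\<close>

section \<open>Triangle-free vertices and local symmetry\<close>

definition neighbours :: "'a ugraph \<Rightarrow> 'a \<Rightarrow> 'a set" where
  "neighbours G v = {u \<in> verts G. {v, u} \<in> edges G}"

definition in_triangle :: "'a ugraph \<Rightarrow> 'a \<Rightarrow> bool" where
  "in_triangle G v \<longleftrightarrow>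
     (\<exists>u \<in> verts G. \<exists>w \<in> verts G. {{v, u}, {v, w}, {u, w}} \<subseteq> edges G)"

lemma singleton_notin_edges:
  assumes "simple_graph G"
  shows "{v} \<notin> edges G"
  using assms by (auto simp: simple_graph_def vertex_pairs_def)

lemma closed_nbhd_eq_insert_neighbours: "closed_nbhd G v = insert v (neighbours G v)"
  by (simp add: closed_nbhd_def neighbours_def)

lemma nbhd_graph_edge_iff_star:
  assumes "simple_graph G" "\<not> in_triangle G v"
    and "u \<in> closed_nbhd G v" "w \<in> closed_nbhd G v"
  shows "{u, w} \<in> edges (nbhd_graph G v) \<longleftrightarrow> (u = v) \<noteq> (w = v)"
  using assms singleton_notin_edges[OF assms(1)]
  by (auto simp: nbhd_graph_def induced_subgraph_def closed_nbhd_def in_triangle_def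
      insert_commute)

text \<open>
  Both neighbourhood graphs are stars, so any bijection between the two neighbour sets, extended
  by sending centre to centre, is an isomorphism.
\<close>

lemma locally_symmetric_if_triangle_free_same_degree:
  assumes G: "simple_graph G"
    and v1: "\<not> in_triangle G v1" and v2: "\<not> in_triangle G v2"
    and deg: "card (neighbours G v1) = card (neighbours G v2)"
  shows "locally_symmetric_vertices G v1 v2"
proof -
  have fin: "finite (neighbours G v)" for v
    using G by (simp add: neighbours_def simple_graph_def)
  have centre: "v \<notin> neighbours G v" for v
    using singleton_notin_edges[OF G] by (simp add: neighbours_def)
  obtain g where g: "bij_betw g (neighbours G v1) (neighbours G v2)"
    using finite_same_card_bij[OF fin fin deg] by blast
  define f where "f = (\<lambda>x. if x = v1 then v2 else g x)"
  have "bij_betw f (neighbours G v1) (neighbours G v2)"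
    using g centre by (subst bij_betw_cong[of _ f g]) (auto simp: f_def)
  then have bij: "bij_betw f (closed_nbhd G v1) (closed_nbhd G v2)"
    using notIn_Un_bij_betw[of v1 "neighbours G v1" f "neighbours G v2"] centre
    by (simp add: closed_nbhd_eq_insert_neighbours f_def)
  have f_centre: "f x = v2 \<longleftrightarrow> x = v1" if "x \<in> closed_nbhd G v1" for x
    using inj_on_eq_iff[OF bij_betw_imp_inj_on[OF bij] that, of v1]
    by (simp add: f_def closed_nbhd_def)
  have "{x, y} \<in> edges (nbhd_graph G v1) \<longleftrightarrow> {f x, f y} \<in> edges (nbhd_graph G v2)"
    if "x \<in> closed_nbhd G v1" "y \<in> closed_nbhd G v1" for x y
    using that bij_betwE[OF bij] f_centre
    by (simp add: nbhd_graph_edge_iff_star[OF G v1] nbhd_graph_edge_iff_star[OF G v2])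
  with bij have "graph_isomorphism f (nbhd_graph G v1) (nbhd_graph G v2)"
    by (simp add: graph_isomorphism_def nbhd_graph_def induced_subgraph_def)
  then show ?thesis
    by (auto simp: locally_symmetric_vertices_def f_def)
qed

text \<open>
  The remaining vertices have pairwise distinct degrees below \<open>k\<close>, so there are at most \<open>k\<close> of them.
\<close>

lemma many_exceptional_if_not_locally_symmetric:
  assumes G: "simple_graph G" and asym: "\<not> locally_symmetric G"
  shows "card (verts G) \<le>
    card {v \<in> verts G. in_triangle G v \<or> k \<le> card (neighbours G v)} + k"
proof -
  let ?E = "{v \<in> verts G. in_triangle G v \<or> k \<le> card (neighbours G v)}"
  let ?O = "{v \<in> verts G. \<not> in_triangle G v \<and> card (neighbours G v) < k}"
  have fin: "finite (verts G)"
    using G by (simp add: simple_graph_def)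
  have "inj_on (\<lambda>v. card (neighbours G v)) ?O"
    using asym locally_symmetric_if_triangle_free_same_degree[OF G]
    by (auto simp: inj_on_def locally_symmetric_def)
  then have "card ?O \<le> card {..<k}"
    by (rule card_inj_on_le) auto
  moreover have "card (verts G) \<le> card ?E + card ?O"
    using fin by (intro order_trans[OF card_mono card_Un_le]) auto
  ultimately show ?thesis by simp
qed

section \<open>First-moment bounds in the random graph\<close>

text \<open>
  Markov's inequality for the number of events that occur, whose expectation is the sum of their
  probabilities by linearity; the events may depend on each other. It serves both for the degree
  of a vertex and for the number of exceptional vertices.
\<close>

lemma prob_many_events_le:
  fixes a :: real
  assumes "finite V" "0 < a"
  shows "measure_pmf.prob M {x. a \<le> card {v \<in> V. P v x}} \<le>
    (\<Sum>v\<in>V. measure_pmf.prob M {x. P v x}) / a"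
proof -
  have card_eq: "real (card {v \<in> V. P v x}) = (\<Sum>v\<in>V. indicator {x. P v x} x)" for x
    using assms(1) by (simp add: indicator_def sum.If_cases Int_def)
  have int: "integrable (measure_pmf M) (\<lambda>x. \<Sum>v\<in>V. indicator {x. P v x} x :: real)"
    by (intro Bochner_Integration.integrable_sum) (simp add: measure_pmf.emeasure_eq_measure)
  have "measure_pmf.prob M {x \<in> space M. a \<le> (\<Sum>v\<in>V. indicator {x. P v x} x :: real)} \<le>
      measure_pmf.expectation M (\<lambda>x. \<Sum>v\<in>V. indicator {x. P v x} x) / a"
    by (rule integral_Markov_inequality_measure[OF int, of "{}"])
      (use assms(2) in \<open>auto intro!: sum_nonneg\<close>)
  also have "measure_pmf.expectation M (\<lambda>x. \<Sum>v\<in>V. indicator {x. P v x} x) =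
      (\<Sum>v\<in>V. measure_pmf.prob M {x. P v x})"
    by (subst Bochner_Integration.integral_sum) (simp_all add: measure_pmf.emeasure_eq_measure)
  finally show ?thesis by (simp add: card_eq)
qed

lemma prob_erdos_renyi_edges_subset:
  assumes p: "0 \<le> p" "p \<le> 1" and S: "S \<subseteq> vertex_pairs {1..n}"
  shows "measure_pmf.prob (erdos_renyi n p) {G. S \<subseteq> edges G} = p ^ card S"
proof -
  let ?E = "vertex_pairs {1..n}"
  let ?B = "\<lambda>e. if e \<in> S then {True} else UNIV"
  let ?X = "Pi_pmf ?E False (\<lambda>_. bernoulli_pmf p)"
  have fin: "finite ?E"
    by (simp add: vertex_pairs_def)
  have "measure_pmf.prob (erdos_renyi n p) {G. S \<subseteq> edges G} =
      measure_pmf.prob ?X (Pi ?E ?B)"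
    unfolding erdos_renyi_def measure_map_pmf
    by (rule arg_cong[where f = "measure_pmf.prob ?X"]) (use S in \<open>auto simp: Pi_iff split: if_splits\<close>)
  also have "\<dots> = (\<Prod>e\<in>?E. measure_pmf.prob (bernoulli_pmf p) (?B e))"
    by (rule measure_Pi_pmf_Pi[OF fin])
  also have "\<dots> = (\<Prod>e\<in>?E. if e \<in> S then p else 1)"
    by (rule prod.cong) (use p in \<open>auto simp: measure_pmf_single\<close>)
  also have "\<dots> = p ^ card S"
    using fin S by (simp add: prod.If_cases Int_absorb1)
  finally show ?thesis .
qed

lemma AE_erdos_renyi_simple:
  "AE G in erdos_renyi n p. simple_graph G \<and> verts G = {1..n}"
  using erdos_renyi_simple_graph by (auto simp: AE_measure_pmf_iff)

text \<open>
  A set containing something that is not a pair of vertices is never part of the edge set, so as an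
  upper bound the formula extends to every \<open>S\<close>. The bounds for a vertex \<open>v\<close> can
  then be stated for every number \<open>v\<close>, in the graph or not.
\<close>

lemma prob_erdos_renyi_edges_le:
  assumes p: "0 \<le> p" "p \<le> 1"
  shows "measure_pmf.prob (erdos_renyi n p) {G. S \<subseteq> edges G} \<le> p ^ card S"
proof (cases "S \<subseteq> vertex_pairs {1..n}")
  case True
  then show ?thesis using prob_erdos_renyi_edges_subset[OF p] by simp
next
  case False
  have "AE G in erdos_renyi n p. \<not> S \<subseteq> edges G"
    by (rule AE_mp[OF AE_erdos_renyi_simple[of n p]], intro AE_I2)
      (use False in \<open>auto simp: simple_graph_def\<close>)
  then have "measure_pmf.prob (erdos_renyi n p) {G. S \<subseteq> edges G} = 0"
    by (subst measure_pmf.prob_eq_0) auto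
  then show ?thesis using p by simp
qed

lemma prob_in_triangle_le:
  assumes p: "0 \<le> p" "p \<le> 1"
  shows "measure_pmf.prob (erdos_renyi n p) {G. in_triangle G v} \<le> real n ^ 2 * p ^ 3"
proof -
  let ?M = "erdos_renyi n p"
  \<comment> \<open>If \<open>u\<close>, \<open>v\<close>, \<open>w\<close> are not distinct, counting the edges involved gives a smaller exponent than
    \<open>3\<close>; such events require a loop, so restricting them to simple graphs makes them empty.\<close>
  let ?T = "\<lambda>(u, w). {G :: nat ugraph. simple_graph G \<and> {{v, u}, {v, w}, {u, w}} \<subseteq> edges G}"
  have "measure_pmf.prob ?M (?T uw) \<le> p ^ 3" for uw
  proof (cases uw)
    case (Pair u w)
    show ?thesis
    proof (cases "v \<noteq> u \<and> v \<noteq> w \<and> u \<noteq> w")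
      case True
      then have "card {{v, u}, {v, w}, {u, w}} = 3"
        by (auto simp: card_insert_if doubleton_eq_iff)
      then have "measure_pmf.prob ?M {G. {{v, u}, {v, w}, {u, w}} \<subseteq> edges G} \<le> p ^ 3"
        using prob_erdos_renyi_edges_le[OF p, of n "{{v, u}, {v, w}, {u, w}}"] by metis
      moreover have "measure_pmf.prob ?M (?T uw) \<le>
          measure_pmf.prob ?M {G. {{v, u}, {v, w}, {u, w}} \<subseteq> edges G}"
        by (intro measure_pmf.finite_measure_mono) (auto simp: Pair)
      ultimately show ?thesis by linarith
    next
      case False
      have "\<not> {{v, u}, {v, w}, {u, w}} \<subseteq> edges G" if "simple_graph G" for G
        using False singleton_notin_edges[OF that] by auto
      then have "?T uw = {}"
        by (auto simp: Pair)
      then show ?thesis using p by simp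
    qed
  qed
  then have "(\<Sum>uw\<in>{1..n} \<times> {1..n}. measure_pmf.prob ?M (?T uw)) \<le>
      (\<Sum>uw\<in>{1..n} \<times> {1..n}. p ^ 3)"
    by (intro sum_mono)
  moreover have "measure_pmf.prob ?M (\<Union>uw\<in>{1..n} \<times> {1..n}. ?T uw) \<le>
      (\<Sum>uw\<in>{1..n} \<times> {1..n}. measure_pmf.prob ?M (?T uw))"
    by (intro measure_pmf.finite_measure_subadditive_finite) auto
  moreover have "measure_pmf.prob ?M {G. in_triangle G v} \<le>
      measure_pmf.prob ?M (\<Union>uw\<in>{1..n} \<times> {1..n}. ?T uw)"
  proof (rule measure_pmf.finite_measure_mono_AE)
    show "AE G in ?M. G \<in> {G. in_triangle G v} \<longrightarrow> G \<in> (\<Union>uw\<in>{1..n} \<times> {1..n}. ?T uw)"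
      using AE_erdos_renyi_simple[of n p]
      by eventually_elim (auto simp: in_triangle_def)
  qed simp
  ultimately show ?thesis
    by (simp add: power2_eq_square)
qed

lemma prob_large_degree_le:
  assumes p: "0 \<le> p" "p \<le> 1" and k: "0 < k"
  shows "measure_pmf.prob (erdos_renyi n p) {G. k \<le> card (neighbours G v)} \<le> real n * p / real k"
proof -
  let ?M = "erdos_renyi n p"
  let ?e = "\<lambda>u (G :: nat ugraph). {v, u} \<in> edges G"
  have "measure_pmf.prob ?M {G. ?e u G} \<le> p" for u
    using prob_erdos_renyi_edges_le[OF p, of n "{{v, u}}"] by simp
  then have "(\<Sum>u\<in>{1..n}. measure_pmf.prob ?M {G. ?e u G}) \<le> (\<Sum>u\<in>{1..n}. p)"
    by (intro sum_mono)
  then have sum: "(\<Sum>u\<in>{1..n}. measure_pmf.prob ?M {G. ?e u G}) / real k \<le> real n * p / real k"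
    by (intro divide_right_mono) auto
  have "measure_pmf.prob ?M {G. k \<le> card (neighbours G v)} \<le>
      measure_pmf.prob ?M {G. real k \<le> card {u \<in> {1..n}. ?e u G}}"
  proof (rule measure_pmf.finite_measure_mono_AE)
    show "AE G in ?M. G \<in> {G. k \<le> card (neighbours G v)} \<longrightarrow>
        G \<in> {G. real k \<le> card {u \<in> {1..n}. ?e u G}}"
      using AE_erdos_renyi_simple[of n p]
      by eventually_elim (auto simp: neighbours_def)
  qed simp
  also have "\<dots> \<le> (\<Sum>u\<in>{1..n}. measure_pmf.prob ?M {G. ?e u G}) / real k"
    by (rule prob_many_events_le) (use k in auto)
  finally show ?thesis using sum by linarith
qed

text \<open>
  The degree threshold is \<open>k = n div 2\<close>. It forces at least \<open>n / 2\<close> exceptional vertices in the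
  absence of local symmetry. The constant \<open>3\<close> bounds \<open>n / k\<close>; it is attained at \<open>n = 3\<close>.
\<close>

lemma prob_not_locally_symmetric_le:
  assumes p: "0 \<le> p" "p \<le> 1" and n: "2 \<le> n"
  shows "measure_pmf.prob (erdos_renyi n p) {G. \<not> locally_symmetric G} \<le>
    2 * (real n ^ 2 * p ^ 3 + 3 * p)"
proof -
  let ?M = "erdos_renyi n p"
  define k where "k = n div 2"
  let ?exc = "\<lambda>v (G :: nat ugraph). in_triangle G v \<or> k \<le> card (neighbours G v)"
  have k: "0 < k" "n \<le> 3 * k" "2 * k \<le> n"
    using n by (auto simp: k_def)
  have deg: "real n * p / real k \<le> 3 * p"
  proof -
    have "real n \<le> 3 * real k"
      using k(2) by linarith
    then have "real n * p \<le> 3 * real k * p"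
      using p(1) by (rule mult_right_mono)
    then show ?thesis using k(1) by (simp add: field_simps)
  qed
  have exc: "measure_pmf.prob ?M {G. ?exc v G} \<le> real n ^ 2 * p ^ 3 + 3 * p" for v
  proof -
    have "measure_pmf.prob ?M {G. ?exc v G} \<le>
        measure_pmf.prob ?M {G. in_triangle G v} +
        measure_pmf.prob ?M {G. k \<le> card (neighbours G v)}"
      unfolding Collect_disj_eq by (rule measure_Un_le) auto
    then show ?thesis
      using prob_in_triangle_le[OF p, of n v] prob_large_degree_le[OF p k(1), of n v] deg
      by linarith
  qed
  have "measure_pmf.prob ?M {G. \<not> locally_symmetric G} \<le>
      measure_pmf.prob ?M {G. real n / 2 \<le> card {v \<in> {1..n}. ?exc v G}}"
  proof (rule measure_pmf.finite_measure_mono_AE)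
    show "AE G in ?M. G \<in> {G. \<not> locally_symmetric G} \<longrightarrow>
        G \<in> {G. real n / 2 \<le> card {v \<in> {1..n}. ?exc v G}}"
      using AE_erdos_renyi_simple[of n p]
    proof eventually_elim
      case (elim G)
      show ?case
      proof
        assume "G \<in> {G. \<not> locally_symmetric G}"
        then have "n \<le> card {v \<in> {1..n}. ?exc v G} + k"
          using many_exceptional_if_not_locally_symmetric[of G k] elim by simp
        then show "G \<in> {G. real n / 2 \<le> card {v \<in> {1..n}. ?exc v G}}"
          using k(3) by simp
      qed
    qed
  qed simp
  also have "\<dots> \<le> (\<Sum>v\<in>{1..n}. measure_pmf.prob ?M {G. ?exc v G}) / (real n / 2)"
    by (rule prob_many_events_le) (use n in auto)
  also have "\<dots> \<le> (\<Sum>v\<in>{1..n}. real n ^ 2 * p ^ 3 + 3 * p) / (real n / 2)"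
    by (intro divide_right_mono sum_mono exc) simp
  also have "\<dots> = 2 * (real n ^ 2 * p ^ 3 + 3 * p)"
    using n by simp
  finally show ?thesis .
qed

section \<open>The sparse regime\<close>

theorem theorem3p1:
  fixes p :: "nat \<Rightarrow> real"
  assumes "\<And>n. 0 \<le> p n \<and> p n \<le> 1"
    and "p \<in> o(\<lambda>n. real n powr (- 2 / 3))"
  shows "(\<lambda>n. measure_pmf.prob (erdos_renyi n (p n)) {G. locally_symmetric G}) \<longlonglongrightarrow> 1"
proof -
  define r where "r = (\<lambda>n. p n / real n powr (- 2 / 3))"
  have r: "r \<longlonglongrightarrow> 0"
    unfolding r_def by (rule smalloD_tendsto[OF assms(2)])
  have triangle: "real n ^ 2 * p n ^ 3 = r n ^ 3" if "2 \<le> n" for n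
  proof -
    have "(real n powr (- 2 / 3)) ^ 3 = real n powr (- 2)"
      using that by (simp flip: powr_realpow add: powr_powr)
    also have "\<dots> = inverse (real n ^ 2)"
      using that by (simp add: powr_minus powr_numeral)
    finally have "r n ^ 3 = p n ^ 3 / inverse (real n ^ 2)"
      by (simp only: r_def power_divide)
    then show ?thesis
      by (simp add: field_simps)
  qed
  have edge: "p n \<le> r n" if "2 \<le> n" for n
  proof -
    have "real n powr (- 2 / 3) \<le> real n powr 0"
      using that by (intro powr_mono) auto
    then have "p n * real n powr (- 2 / 3) \<le> p n * 1"
      using that assms(1) by (intro mult_left_mono) auto
    then show ?thesis
      using that by (simp add: r_def field_simps)
  qed
  have "(\<lambda>n. measure_pmf.prob (erdos_renyi n (p n)) {G. \<not> locally_symmetric G}) \<longlonglongrightarrow> 0"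
  proof (rule tendsto_sandwich)
    show "(\<lambda>_. 0 :: real) \<longlonglongrightarrow> 0"
      by simp
    show "(\<lambda>n. 2 * (r n ^ 3 + 3 * r n)) \<longlonglongrightarrow> 0"
      using r by (auto intro!: tendsto_eq_intros)
    show "\<forall>\<^sub>F n in sequentially.
        measure_pmf.prob (erdos_renyi n (p n)) {G. \<not> locally_symmetric G} \<le>
          2 * (r n ^ 3 + 3 * r n)"
      using eventually_ge_at_top[of 2]
    proof eventually_elim
      case (elim n)
      then show ?case
        using prob_not_locally_symmetric_le[of "p n" n] assms(1)[of n] triangle[of n] edge[of n]
        by auto
    qed
  qed simp
  moreover have "measure_pmf.prob (erdos_renyi n (p n)) {G. locally_symmetric G} =
      1 - measure_pmf.prob (erdos_renyi n (p n)) {G. \<not> locally_symmetric G}" for n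
    using measure_pmf.prob_neg[of "erdos_renyi n (p n)" "\<lambda>G. \<not> locally_symmetric G"] by simp
  ultimately show ?thesis
    by (auto intro!: tendsto_eq_intros)
qed

end
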